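(* Let $\Omega\subset\mathbb{R}^2$ be a bounded domain with smooth boundary, and let $\mathbf{B}$ be a smooth $2$-form (magnetic field) on $\Omega$. For every connected component $\mathcal{C}$ of $\partial\Omega$, write $\mathbf{B}=B(n,s)\,dn\wedge ds$ on the collar $\Omega_{\mathcal{C}}(N)$ using the normal coordinates $(n,s)$ (defined in the context). Suppose that for every component $\mathcal{C}$ and every $s$, $$\lim_{n\to 0^+}\left|\int_n^N B(u,s)\,du\right|=\infty ,$$ and that for every component $\mathcal{C}$ there is a constant $D_{\mathcal{C}}$ such that $$\sup_s\int_0^N\left|\frac{\partial B}{\partial s}(u,s)\right|du<D_{\mathcal{C}} .$$ Then no trajectory of the magnetic flow starting in $\Omega$ reaches $\partial\Omega$ in finite time. That is, there is no $0<T<\infty$ and no solution $q:[0,T)\to\Omega$ of the magnetic equations of motion such that $\lim_{t\to T^-}q(t)$ exists and belongs to $\partial\Omega$.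
   Context: $\mathbb{R}^2$ carries the Euclidean metric; a domain is a connected open set. Fix a mass $m>0$ and a charge $e\neq 0$. Magnetic equations of motion: writing $\mathbf{B}=b(x,y)\,dx\wedge dy$ in Cartesian coordinates, a trajectory of the magnetic flow is a curve $q(t)$ in $\Omega$ satisfying $m\ddot q=-e\,b(q)\,J\dot q$, where $J=\left(\begin{smallmatrix}0&-1\\1&0\end{smallmatrix}\right)$. Normal coordinates: let $\mathcal{C}$ be a connected component of $\partial\Omega$, of length $L$. Let $\gamma:\mathbb{R}/L\mathbb{Z}\to\mathcal{C}$ be an arc length parametrization and let $\nu(s)$ be the unit normal to $\mathcal{C}$ at $\gamma(s)$ pointing into $\Omega$. Define $x(n,s)=\gamma(s)+n\nu(s)$. A number $N>0$ is fixed, small enough that for every component $\mathcal{C}$ there is $N'>N$ for which $x$ is a diffeomorphism of $(0,N')\times\mathbb{R}/L\mathbb{Z}$ onto an open subset of $\Omega$. The collar $\Omega_{\mathcal{C}}(N)\subset\Omega$ is the image $x\big((0,N)\times\mathbb{R}/L\mathbb{Z}\big)$. The function $B(n,s)$ is the coefficient of $\mathbf{B}$ with respect to $dn\wedge ds$ in these coordinates (it depends on $\mathcal{C}$). *)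

theory Defs
  imports "HOL-Analysis.Analysis"
begin

text \<open>\<open>C_k_on k S f\<close> is meant for open \<open>S\<close>; it says that \<open>f\<close> is of class $C^k$ on \<open>S\<close>.\<close>

fun C_k_on :: "nat \<Rightarrow> 'a::real_normed_vector set \<Rightarrow> ('a \<Rightarrow> 'b::real_normed_vector) \<Rightarrow> bool" where
  "C_k_on 0 S f \<longleftrightarrow> continuous_on S f"
| "C_k_on (Suc k) S f \<longleftrightarrow>
     (\<forall>x\<in>S. f differentiable (at x)) \<and>
     (\<forall>v. C_k_on k S (\<lambda>x. frechet_derivative f (at x) v))"

definition smooth_on :: "'a::real_normed_vector set \<Rightarrow> ('a \<Rightarrow> 'b::real_normed_vector) \<Rightarrow> bool" where
  "smooth_on S f \<longleftrightarrow> (\<forall>k. C_k_on k S f)"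

text \<open>A smooth boundary is described by local defining functions: near each of its points the set
  lies strictly on one side of a regular level curve.\<close>

definition smooth_boundary :: "(real^2) set \<Rightarrow> bool" where
  "smooth_boundary \<Omega> \<longleftrightarrow>
     (\<forall>p\<in>frontier \<Omega>. \<exists>U (\<rho> :: real^2 \<Rightarrow> real). open U \<and> p \<in> U \<and> smooth_on U \<rho> \<and>
        (\<forall>x\<in>U. frechet_derivative \<rho> (at x) \<noteq> (\<lambda>v. 0)) \<and>
        \<Omega> \<inter> U = {x\<in>U. \<rho> x < 0})"

text \<open>Maps on $\mathbb{R}/L\mathbb{Z}$ are represented by \<open>L\<close>-periodic maps on the real line.\<close>

definition arc_length_param :: "(real^2) set \<Rightarrow> real \<Rightarrow> (real \<Rightarrow> real^2) \<Rightarrow> bool" where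
  "arc_length_param C L \<gamma> \<longleftrightarrow>
     L > 0 \<and> smooth_on UNIV \<gamma> \<and>
     (\<forall>s. norm (vector_derivative \<gamma> (at s)) = 1) \<and>
     (\<forall>s. \<gamma> (s + L) = \<gamma> s) \<and> inj_on \<gamma> {0..<L} \<and> range \<gamma> = C"

definition inward_unit_normal ::
    "(real^2) set \<Rightarrow> (real \<Rightarrow> real^2) \<Rightarrow> (real \<Rightarrow> real^2) \<Rightarrow> bool" where
  "inward_unit_normal \<Omega> \<gamma> \<nu> \<longleftrightarrow>
     (\<forall>s. norm (\<nu> s) = 1 \<and> \<nu> s \<bullet> vector_derivative \<gamma> (at s) = 0 \<and>
          (\<exists>\<epsilon>>0. \<forall>n\<in>{0<..<\<epsilon>}. \<gamma> s + n *\<^sub>R \<nu> s \<in> \<Omega>))"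

definition normal_coords :: "(real \<Rightarrow> real^2) \<Rightarrow> (real \<Rightarrow> real^2) \<Rightarrow> real \<times> real \<Rightarrow> real^2" where
  "normal_coords \<gamma> \<nu> = (\<lambda>(n, s). \<gamma> s + n *\<^sub>R \<nu> s)"

text \<open>\<open>x\<close> induces a diffeomorphism of $(0,a) \times \mathbb{R}/L\mathbb{Z}$ onto an open subset of
  \<open>\<Omega>\<close>. As the quotient map $\mathbb{R} \to \mathbb{R}/L\mathbb{Z}$ is a local diffeomorphism,
  smoothness of the inverse means that it has smooth lifts \<open>g\<close> to $(0,a) \times \mathbb{R}$
  near every point of the image.\<close>

definition periodic_diffeo_into ::
    "(real^2) set \<Rightarrow> real \<Rightarrow> real \<Rightarrow> (real \<times> real \<Rightarrow> real^2) \<Rightarrow> bool" where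
  "periodic_diffeo_into \<Omega> a L x \<longleftrightarrow>
     (let S = {0<..<a} \<times> (UNIV :: real set) in
        smooth_on S x \<and>
        (\<forall>(n, s)\<in>S. x (n, s + L) = x (n, s)) \<and>
        (\<forall>(n, s)\<in>S. \<forall>(n', s')\<in>S. x (n, s) = x (n', s') \<longrightarrow>
            n = n' \<and> (\<exists>k::int. s' = s + of_int k * L)) \<and>
        open (x ` S) \<and> x ` S \<subseteq> \<Omega> \<and>
        (\<forall>p \<in> x ` S. \<exists>W g. open W \<and> p \<in> W \<and> smooth_on W g \<and>
            (\<forall>y\<in>W. g y \<in> S \<and> x (g y) = y)))"

text \<open>The value at \<open>p\<close> of the 2-form \<open>b dx \<and> dy\<close> on the pair of vectors \<open>v\<close>, \<open>w\<close>.\<close>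

definition area_form :: "(real^2 \<Rightarrow> real) \<Rightarrow> real^2 \<Rightarrow> real^2 \<Rightarrow> real^2 \<Rightarrow> real" where
  "area_form b p v w = b p * (v $ 1 * w $ 2 - v $ 2 * w $ 1)"

text \<open>The coefficient with respect to \<open>dn \<and> ds\<close> of the pullback of \<open>b dx \<and> dy\<close> along the normal
  coordinates, i.e. the pullback evaluated on the pair of coordinate vectors.\<close>

definition field_coeff ::
    "(real^2 \<Rightarrow> real) \<Rightarrow> (real \<Rightarrow> real^2) \<Rightarrow> (real \<Rightarrow> real^2) \<Rightarrow> real \<Rightarrow> real \<Rightarrow> real" where
  "field_coeff b \<gamma> \<nu> n s =
     (let x = normal_coords \<gamma> \<nu>; Dx = frechet_derivative x (at (n, s))
      in area_form b (x (n, s)) (Dx (1, 0)) (Dx (0, 1)))"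

definition J :: "real^2^2" where
  "J = vector [vector [0, -1], vector [1, 0]]"

text \<open>Derivatives are taken within \<open>[0,T)\<close>, hence one-sided at time \<open>0\<close>.\<close>

definition magnetic_trajectory ::
    "real \<Rightarrow> real \<Rightarrow> (real^2 \<Rightarrow> real) \<Rightarrow> (real^2) set \<Rightarrow> real \<Rightarrow> (real \<Rightarrow> real^2) \<Rightarrow> bool" where
  "magnetic_trajectory m e b \<Omega> T q \<longleftrightarrow>
     (\<exists>v a. \<forall>t\<in>{0..<T}.
        q t \<in> \<Omega> \<and>
        (q has_vector_derivative v t) (at t within {0..<T}) \<and>
        (v has_vector_derivative a t) (at t within {0..<T}) \<and>
        m *\<^sub>R a t = - (e * b (q t)) *\<^sub>R (J *v v t))"

end

theory Submission imports Defs begin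

text \<open>Near the limit point the trajectory lies in one collar, with normal coordinates \<open>(n, s)\<close>
  tending to \<open>(0, s0)\<close>. With \<open>H(n, s) = \<integral>\<^sub>n\<^sup>N B(u, s) du\<close>, the canonical momentum
  \<open>m v \<bullet> \<partial>x/\<partial>s - e H(n, s)\<close> along the trajectory has a bounded derivative: the terms
  \<open>e B(n, s) dn/dt\<close> coming from the force and from \<open>dH/dt\<close> cancel, the speed is constant, and
  \<open>\<partial>H/\<partial>s\<close> is bounded by the hypothesis on \<open>\<partial>B/\<partial>s\<close>. Hence \<open>H\<close> stays bounded in finite time, also
  along \<open>s = s0\<close> since \<open>H\<close> is Lipschitz in \<open>s\<close>, which contradicts its divergence at \<open>n = 0\<close>.\<close>

section \<open>Differentiation of smooth maps\<close>

lemma smooth_on_has_derivative: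
  assumes "smooth_on S f" "x \<in> S"
  shows "(f has_derivative frechet_derivative f (at x)) (at x)"
proof -
  have "C_k_on (Suc 0) S f" using assms(1) by (auto simp: smooth_on_def)
  then show ?thesis using assms(2) by (simp add: frechet_derivative_works)
qed

lemma smooth_on_frechet_derivative:
  assumes "smooth_on S f"
  shows "smooth_on S (\<lambda>x. frechet_derivative f (at x) v)"
  unfolding smooth_on_def
proof
  fix k
  have "C_k_on (Suc k) S f" using assms by (auto simp: smooth_on_def)
  then show "C_k_on k S (\<lambda>x. frechet_derivative f (at x) v)" by simp
qed

lemma smooth_on_continuous_on: "smooth_on S f \<Longrightarrow> continuous_on S f"
  unfolding smooth_on_def using C_k_on.simps(1) by blast

text \<open>\<open>smooth_on\<close> controls the derivative only in one fixed direction at a time.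
  Expanding the direction in the basis reduces a varying direction \<open>w z\<close> to finitely
  many fixed ones.\<close>

lemma continuous_on_frechet_derivative_apply:
  fixes f :: "'a::euclidean_space \<Rightarrow> 'b::real_normed_vector"
  assumes f: "smooth_on S f" and h: "continuous_on A h" "h ` A \<subseteq> S" and w: "continuous_on A w"
  shows "continuous_on A (\<lambda>z. frechet_derivative f (at (h z)) (w z))"
proof -
  have "frechet_derivative f (at (h z)) (w z) =
      (\<Sum>i\<in>Basis. (w z \<bullet> i) *\<^sub>R frechet_derivative f (at (h z)) i)" if "z \<in> A" for z
  proof -
    have "h z \<in> S" using h that by auto
    then interpret bounded_linear "frechet_derivative f (at (h z))"
      using smooth_on_has_derivative[OF f] has_derivative_bounded_linear by blast
    have "frechet_derivative f (at (h z)) (w z)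
        = frechet_derivative f (at (h z)) (\<Sum>i\<in>Basis. (w z \<bullet> i) *\<^sub>R i)"
      by (simp add: euclidean_representation)
    then show ?thesis by (simp add: sum scale)
  qed
  moreover have "continuous_on A (\<lambda>z. \<Sum>i\<in>Basis. (w z \<bullet> i) *\<^sub>R frechet_derivative f (at (h z)) i)"
  proof (intro continuous_intros w)
    fix i :: 'a
    show "continuous_on A (\<lambda>z. frechet_derivative f (at (h z)) i)"
      using continuous_on_compose2[OF smooth_on_continuous_on[OF smooth_on_frechet_derivative[OF f]] h] .
  qed
  ultimately show ?thesis by (simp cong: continuous_on_cong)
qed

lemma smooth_on_line:
  assumes f: "smooth_on S f" and line: "\<And>s::real. c + s *\<^sub>R v \<in> S"
  shows "((\<lambda>s. f (c + s *\<^sub>R v)) has_vector_derivative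
            frechet_derivative f (at (c + s *\<^sub>R v)) v) (at s)"
proof -
  have "((\<lambda>s. c + s *\<^sub>R v) has_derivative (\<lambda>h. h *\<^sub>R v)) (at s)"
    by (auto intro!: derivative_eq_intros)
  from has_derivative_compose[OF this smooth_on_has_derivative[OF f line]]
  have "((\<lambda>s. f (c + s *\<^sub>R v)) has_derivative
      (\<lambda>h. frechet_derivative f (at (c + s *\<^sub>R v)) (h *\<^sub>R v))) (at s)" .
  moreover have "linear (frechet_derivative f (at (c + s *\<^sub>R v)))"
    using smooth_on_has_derivative[OF f line] has_derivative_linear by blast
  ultimately show ?thesis
    by (simp add: has_vector_derivative_def linear_scale)
qed

text \<open>Supplies ordinary C^2 curves from smooth maps. It is applied to a boundary curve itself
  and to a curve \<open>s \<mapsto> x(n, s)\<close> at constant height \<open>n\<close>.\<close>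

lemma smooth_on_line_C2:
  assumes f: "smooth_on S f" and line: "\<And>s::real. c + s *\<^sub>R v \<in> S"
  obtains f1 f2 where
    "\<And>s. ((\<lambda>s. f (c + s *\<^sub>R v)) has_vector_derivative f1 s) (at s)"
    "\<And>s. (f1 has_vector_derivative f2 s) (at s)"
    "continuous_on UNIV f2"
proof
  let ?f1 = "\<lambda>x. frechet_derivative f (at x) v"
  let ?f2 = "\<lambda>x. frechet_derivative ?f1 (at x) v"
  note s1 = smooth_on_frechet_derivative[OF f, of v]
  note s2 = smooth_on_frechet_derivative[OF s1, of v]
  show "((\<lambda>s. f (c + s *\<^sub>R v)) has_vector_derivative ?f1 (c + s *\<^sub>R v)) (at s)" for s
    by (rule smooth_on_line[OF f line])
  show "((\<lambda>s. ?f1 (c + s *\<^sub>R v)) has_vector_derivative ?f2 (c + s *\<^sub>R v)) (at s)" for s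
    by (rule smooth_on_line[OF s1 line])
  show "continuous_on UNIV (\<lambda>s. ?f2 (c + s *\<^sub>R v))"
    by (rule continuous_on_compose2[OF smooth_on_continuous_on[OF s2]])
      (auto intro!: continuous_intros line)
qed

section \<open>The integral of the field coefficient across the collar\<close>

text \<open>\<open>B'\<close> plays the role of the partial derivative of \<open>B\<close> in
  \<open>s\<close>, and \<open>M\<close> that of the larger width \<open>N'\<close> of the normal
  coordinates. Since \<open>N < M\<close>, the integrands are continuous up to the endpoint
  \<open>N\<close>, so that only \<open>n = 0\<close> is singular.\<close>

locale magnetic_collar =
  fixes B B' :: "real \<Rightarrow> real \<Rightarrow> real" and M N D :: real
  assumes N: "0 < N" "N < M"
    and cont_B: "continuous_on ({0<..<M} \<times> UNIV) (\<lambda>(u, s). B u s)"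
    and cont_B': "continuous_on ({0<..<M} \<times> UNIV) (\<lambda>(u, s). B' u s)"
    and deriv_B: "\<And>u s. 0 < u \<Longrightarrow> u < M \<Longrightarrow> (B u has_real_derivative B' u s) (at s)"
    and bound_B': "(SUP s. \<integral>\<^sup>+u\<in>{0<..<N}. ennreal \<bar>B' u s\<bar> \<partial>lborel) < ennreal D"
begin

definition H :: "real \<Rightarrow> real \<Rightarrow> real" where
  "H n s = integral {n..N} (\<lambda>u. B u s)"

definition H' :: "real \<Rightarrow> real \<Rightarrow> real" where
  "H' n s = integral {n..N} (\<lambda>u. B' u s)"

lemma continuous_slice:
  assumes "continuous_on ({0<..<M} \<times> UNIV) (\<lambda>(u, s). F u s)" and "0 < n"
  shows "continuous_on {n..N} (\<lambda>u. F u s)"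
proof -
  have "continuous_on {n..N} (\<lambda>u. (\<lambda>(u, s). F u s) (u, s))"
    by (rule continuous_on_compose2[OF assms(1)]) (use assms N in \<open>auto intro!: continuous_intros\<close>)
  then show ?thesis by simp
qed

lemma H_s_derivative:
  assumes "0 < n"
  shows "(H n has_real_derivative H' n s) (at s)"
proof -
  have "((\<lambda>s. integral (cbox n N) (\<lambda>u. B u s)) has_field_derivative
      integral (cbox n N) (\<lambda>u. B' u s)) (at s within UNIV)"
  proof (rule leibniz_rule_field_derivative)
    show "((\<lambda>x. B t x) has_field_derivative B' t x) (at x within UNIV)" if "t \<in> cbox n N" for x t
      using deriv_B[of t x] that assms N by auto
    show "(\<lambda>u. B u x) integrable_on cbox n N" for x
      using integrable_continuous_real[OF continuous_slice[OF cont_B assms]] by simp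
    have "continuous_on (UNIV \<times> cbox n N) (\<lambda>z. (\<lambda>(u, s). B' u s) (snd z, fst z))"
      by (rule continuous_on_compose2[OF cont_B'])
        (use assms N in \<open>auto intro!: continuous_intros\<close>)
    then show "continuous_on (UNIV \<times> cbox n N) (\<lambda>(x, t). B' t x)"
      by (simp add: split_beta')
  qed auto
  then show ?thesis by (simp add: H_def[abs_def] H'_def)
qed

lemma H_n_derivative:
  assumes "0 < n" "n < N"
  shows "((\<lambda>n. H n s) has_real_derivative - B n s) (at n)"
proof -
  \<comment> \<open>The interval \<open>{n/2..N}\<close> has \<open>n\<close> in its interior and
    stays away from the singularity at 0. The minus sign appears because \<open>n\<close> is the
    lower limit of integration.\<close>
  have "((\<lambda>n. H n s) has_real_derivative - B n s) (at n within {n/2..N})"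
    unfolding H_def
    by (rule integral_has_real_derivative') (use continuous_slice[OF cont_B, of "n/2"] assms in auto)
  moreover have "at n within {n/2..N} = at n"
    using assms by (intro at_within_interior) auto
  ultimately show ?thesis by simp
qed

text \<open>Total differentiability follows from the partial derivative in \<open>s\<close> at the
  point and a continuous partial derivative \<open>- B\<close> in \<open>n\<close>. The pair is
  ordered \<open>(s, n)\<close> to put the continuous partial derivative in the second slot.\<close>

lemma H_has_derivative:
  assumes "0 < n" "n < N"
  shows "((\<lambda>(s, n). H n s) has_derivative (\<lambda>(ds, dn). H' n s * ds - B n s * dn)) (at (s, n))"
proof -
  have "((\<lambda>(s, n). H n s) has_derivative
      (\<lambda>(ds, dn). H' n s * ds + blinfun_scaleR_right (- B n s) dn))
      (at (s, n) within UNIV \<times> {0<..<N})"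
  proof (rule has_derivative_partialsI)
    show "((\<lambda>s. H n s) has_derivative (\<lambda>ds. H' n s * ds)) (at s within UNIV)"
      using H_s_derivative[OF assms(1)] by (simp add: has_field_derivative_def)
    show "((\<lambda>n. H n s) has_derivative blinfun_apply (blinfun_scaleR_right (- B n s)))
        (at n within {0<..<N})" if "n \<in> {0<..<N}" for s n
    proof -
      have "((*\<^sub>R) c :: real \<Rightarrow> real) = (*) c" for c by (simp add: fun_eq_iff)
      then show ?thesis
        using H_n_derivative[of n s] that
        by (auto simp: has_field_derivative_def intro: has_derivative_at_withinI)
    qed
    have "continuous_on (UNIV \<times> {0<..<N}) (\<lambda>z. (\<lambda>(u, s). B u s) (snd z, fst z))"
      by (rule continuous_on_compose2[OF cont_B])
        (use assms N in \<open>auto intro!: continuous_intros\<close>)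
    then have "continuous_on (UNIV \<times> {0<..<N}) (\<lambda>(s, n). B n s)"
      by (simp add: split_beta')
    then have "continuous_on (UNIV \<times> {0<..<N}) (\<lambda>(s, n). blinfun_scaleR_right (- B n s))"
      by (auto simp: split_beta' intro!: continuous_intros)
    then show "continuous (at (s, n) within UNIV \<times> {0<..<N})
        (\<lambda>(s, n). blinfun_scaleR_right (- B n s))"
      using assms by (auto simp only: continuous_on_eq_continuous_within SigmaI UNIV_I greaterThanLessThan_iff)
  qed (use assms in auto)
  moreover have "at (s, n) within UNIV \<times> {0<..<N} = at (s, n)"
    using assms by (intro at_within_open) (auto intro!: open_Times)
  ultimately show ?thesis
    by (simp add: split_beta' algebra_simps)
qed

text \<open>The integral over \<open>{n..N}\<close> is dominated by the one over the whole width of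
  the collar. The bound is therefore uniform in \<open>n\<close>, which is what survives the limit
  \<open>n \<rightarrow> 0\<close>.\<close>

lemma H'_bound:
  assumes "0 < n"
  shows "\<bar>H' n s\<bar> \<le> D"
proof -
  have c: "continuous_on {n..N} (\<lambda>u. B' u s)" by (rule continuous_slice[OF cont_B' assms])
  then have ca: "continuous_on {n..N} (\<lambda>u. \<bar>B' u s\<bar>)" by (intro continuous_intros)
  let ?I = "integral {n..N} (\<lambda>u. \<bar>B' u s\<bar>)"
  have "((\<lambda>u. \<bar>B' u s\<bar>) has_integral ?I) {n..N}"
    by (intro integrable_integral integrable_continuous_real ca)
  then have "ennreal ?I = (\<integral>\<^sup>+u\<in>{n..N}. ennreal \<bar>B' u s\<bar> \<partial>lborel)"
    by (subst nn_integral_has_integral_lebesgue') auto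
  also have "\<dots> \<le> (\<integral>\<^sup>+u\<in>{0<..<N}. ennreal \<bar>B' u s\<bar> \<partial>lborel)"
  proof (rule nn_integral_mono_AE)
    \<comment> \<open>The closed interval contains \<open>N\<close> and the open one does not; a
      single point is a null set.\<close>
    have "AE u in lborel. u \<noteq> N" by (rule AE_lborel_singleton)
    then show "AE u in lborel. ennreal \<bar>B' u s\<bar> * indicator {n..N} u
        \<le> ennreal \<bar>B' u s\<bar> * indicator {0<..<N} u"
      by eventually_elim (use assms in \<open>auto simp: indicator_def\<close>)
  qed
  also have "\<dots> \<le> (SUP s. \<integral>\<^sup>+u\<in>{0<..<N}. ennreal \<bar>B' u s\<bar> \<partial>lborel)"
    by (rule SUP_upper) simp
  also have "\<dots> < ennreal D" by (rule bound_B')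
  finally have "?I < D"
    by (simp add: ennreal_less_iff integral_nonneg integrable_continuous_real[OF ca])
  moreover have "\<bar>H' n s\<bar> \<le> ?I"
    unfolding H'_def using integral_norm_bound_integral[of "\<lambda>u. B' u s" "{n..N}" "\<lambda>u. \<bar>B' u s\<bar>"]
      integrable_continuous_real[OF c] integrable_continuous_real[OF ca] by simp
  ultimately show ?thesis by simp
qed

text \<open>Mean value inequality in \<open>s\<close>. As the constant does not depend on
  \<open>n\<close>, a bound on \<open>H\<close> along the moving \<open>s\<close> carries over to
  the fixed \<open>s0\<close>.\<close>

lemma H_Lipschitz:
  assumes "0 < n"
  shows "\<bar>H n s - H n s'\<bar> \<le> D * \<bar>s - s'\<bar>"
  using field_differentiable_bound[of UNIV "H n" "H' n" D s s']
    H_s_derivative[OF assms] H'_bound[OF assms] by simp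

end

section \<open>The area form of the plane\<close>

definition det2 :: "real^2 \<Rightarrow> real^2 \<Rightarrow> real" where
  "det2 v w = v $ 1 * w $ 2 - v $ 2 * w $ 1"

lemma bounded_bilinear_det2: "bounded_bilinear det2"
proof -
  have "bounded_bilinear (\<lambda>v w :: real^2. inner (J *v v) w)"
    by (rule bounded_bilinear.comp1[OF bounded_bilinear_inner matrix_vector_mul_bounded_linear])
  moreover have "(\<lambda>v w. inner (J *v v) w) = det2"
    by (auto simp: fun_eq_iff det2_def J_def inner_vec_def sum_2 matrix_vector_mult_def algebra_simps)
  ultimately show ?thesis by simp
qed

interpretation det2: bounded_bilinear det2 by (rule bounded_bilinear_det2)

text \<open>Pairing the magnetic force with a vector thus becomes an evaluation of the area form,
  the same form that defines the field coefficient.\<close>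

lemma J_inner: "(J *v v) \<bullet> w = det2 v w"
  by (simp add: det2_def J_def inner_vec_def sum_2 matrix_vector_mult_def algebra_simps)

lemma det2_self [simp]: "det2 v v = 0"
  by (simp add: det2_def)

text \<open>The remainder \<open>w\<close> is orthogonal to \<open>a\<close> and \<open>b\<close>.
  By the Lagrange identity \<open>det2 a b\<close> has square 1, and Cramer's rule then forces
  \<open>w = 0\<close>.\<close>

lemma orthonormal_expansion_2:
  fixes a b v :: "real^2"
  assumes "norm a = 1" "norm b = 1" "a \<bullet> b = 0"
  shows "v = (v \<bullet> a) *\<^sub>R a + (v \<bullet> b) *\<^sub>R b"
proof -
  have aa: "a \<bullet> a = 1" and bb: "b \<bullet> b = 1" and ba: "b \<bullet> a = 0"
    using assms by (auto simp: norm_eq_1 inner_commute)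
  define w where "w = v - (v \<bullet> a) *\<^sub>R a - (v \<bullet> b) *\<^sub>R b"
  have wa: "w \<bullet> a = 0" and wb: "w \<bullet> b = 0"
    using assms aa bb ba by (auto simp: w_def inner_diff_left)
  have "(det2 a b)\<^sup>2 = (a \<bullet> a) * (b \<bullet> b) - (a \<bullet> b)\<^sup>2"
    by (simp add: det2_def inner_vec_def sum_2 power2_eq_square algebra_simps)
  then have d: "det2 a b \<noteq> 0" using aa bb assms by auto
  have "w $ 1 * det2 a b = b $ 2 * (w \<bullet> a) - a $ 2 * (w \<bullet> b)"
    "w $ 2 * det2 a b = a $ 1 * (w \<bullet> b) - b $ 1 * (w \<bullet> a)"
    by (simp_all add: det2_def inner_vec_def sum_2 algebra_simps)
  then have "w = 0" using wa wb d by (simp add: vec_eq_iff forall_2)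
  then show ?thesis by (simp add: w_def algebra_simps)
qed

section \<open>Normal coordinates along a curve with a unit normal\<close>

text \<open>Two derivatives of both curve and normal are carried along: the coordinate vector in
  \<open>s\<close> contains first derivatives, and differentiating it along a trajectory, or the
  field coefficient in \<open>s\<close>, brings in the second ones.\<close>

locale normal_frame =
  fixes \<gamma> \<gamma>1 \<gamma>2 \<nu> \<nu>1 \<nu>2 :: "real \<Rightarrow> real^2"
  assumes \<gamma>: "\<And>s. (\<gamma> has_vector_derivative \<gamma>1 s) (at s)"
    and \<gamma>1: "\<And>s. (\<gamma>1 has_vector_derivative \<gamma>2 s) (at s)"
    and \<nu>: "\<And>s. (\<nu> has_vector_derivative \<nu>1 s) (at s)"
    and \<nu>1: "\<And>s. (\<nu>1 has_vector_derivative \<nu>2 s) (at s)"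
    and cont2: "continuous_on UNIV \<gamma>2" "continuous_on UNIV \<nu>2"
    and norm_\<gamma>1: "\<And>s. norm (\<gamma>1 s) = 1"
    and norm_\<nu>: "\<And>s. norm (\<nu> s) = 1"
    and \<nu>_\<gamma>1: "\<And>s. \<nu> s \<bullet> \<gamma>1 s = 0"
begin

definition X :: "real \<Rightarrow> real \<Rightarrow> real^2" where
  "X n s = \<gamma> s + n *\<^sub>R \<nu> s"

text \<open>The coordinate vector of \<open>X\<close> in the direction \<open>s\<close>; the one in
  the direction \<open>n\<close> is \<open>\<nu> s\<close>.\<close>

definition Xs :: "real \<Rightarrow> real \<Rightarrow> real^2" where
  "Xs n s = \<gamma>1 s + n *\<^sub>R \<nu>1 s"

lemma continuous_on_frame [continuous_intros]:
  assumes "continuous_on A f"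
  shows "continuous_on A (\<lambda>x. \<gamma> (f x))" "continuous_on A (\<lambda>x. \<gamma>1 (f x))"
    "continuous_on A (\<lambda>x. \<gamma>2 (f x))" "continuous_on A (\<lambda>x. \<nu> (f x))"
    "continuous_on A (\<lambda>x. \<nu>1 (f x))" "continuous_on A (\<lambda>x. \<nu>2 (f x))"
proof -
  have "continuous_on UNIV \<gamma>" "continuous_on UNIV \<gamma>1" "continuous_on UNIV \<nu>" "continuous_on UNIV \<nu>1"
    using \<gamma> \<gamma>1 \<nu> \<nu>1 has_vector_derivative_continuous
    by (blast intro: continuous_at_imp_continuous_on)+
  then show "continuous_on A (\<lambda>x. \<gamma> (f x))" "continuous_on A (\<lambda>x. \<gamma>1 (f x))"
    "continuous_on A (\<lambda>x. \<gamma>2 (f x))" "continuous_on A (\<lambda>x. \<nu> (f x))"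
    "continuous_on A (\<lambda>x. \<nu>1 (f x))" "continuous_on A (\<lambda>x. \<nu>2 (f x))"
    using cont2 continuous_on_compose2[OF _ assms] by blast+
qed

lemma \<nu>_\<nu>1: "\<nu> s \<bullet> \<nu>1 s = 0"
proof -
  have "((\<lambda>s. \<nu> s \<bullet> \<nu> s) has_vector_derivative \<nu> s \<bullet> \<nu>1 s + \<nu>1 s \<bullet> \<nu> s) (at s)"
    by (rule bounded_bilinear.has_vector_derivative[OF bounded_bilinear_inner \<nu> \<nu>])
  moreover have "(\<lambda>s. \<nu> s \<bullet> \<nu> s) = (\<lambda>s. 1)"
    using norm_\<nu> by (simp add: norm_eq_1)
  ultimately have "((\<lambda>s. 1::real) has_vector_derivative \<nu> s \<bullet> \<nu>1 s + \<nu>1 s \<bullet> \<nu> s) (at s)" by simp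
  from vector_derivative_unique_at[OF this has_vector_derivative_const]
  show ?thesis by (simp add: inner_commute)
qed

text \<open>The coordinate vectors are orthogonal because \<nu> is normal to the curve and, having
  constant length, also to its own derivative.\<close>

lemma \<nu>_Xs: "\<nu> s \<bullet> Xs n s = 0"
  by (simp add: Xs_def inner_add_right \<nu>_\<gamma>1 \<nu>_\<nu>1)

lemma normal_coords_has_derivative:
  "(normal_coords \<gamma> \<nu> has_derivative (\<lambda>(dn, ds). dn *\<^sub>R \<nu> s + ds *\<^sub>R Xs n s)) (at (n, s))"
proof -
  have g: "((\<lambda>z::real\<times>real. \<gamma> (snd z)) has_derivative (\<lambda>h. snd h *\<^sub>R \<gamma>1 s)) (at (n, s))"
    using has_derivative_compose[OF has_derivative_snd[OF has_derivative_ident] , of \<gamma> _ "(n,s)"]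
      \<gamma>[of s] by (simp add: has_vector_derivative_def)
  have v: "((\<lambda>z::real\<times>real. \<nu> (snd z)) has_derivative (\<lambda>h. snd h *\<^sub>R \<nu>1 s)) (at (n, s))"
    using has_derivative_compose[OF has_derivative_snd[OF has_derivative_ident] , of \<nu> _ "(n,s)"]
      \<nu>[of s] by (simp add: has_vector_derivative_def)
  show ?thesis
    unfolding normal_coords_def split_beta'
    by (rule derivative_eq_intros g v refl)+ (auto simp: fun_eq_iff Xs_def algebra_simps)
qed

lemma field_coeff_eq: "field_coeff b \<gamma> \<nu> n s = b (X n s) * det2 (\<nu> s) (Xs n s)"
  unfolding field_coeff_def Let_def
    frechet_derivative_at[OF normal_coords_has_derivative[of s n], symmetric]
  by (simp add: area_form_def det2_def normal_coords_def X_def)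

lemma X_has_vector_derivative: "((\<lambda>s. X n s) has_vector_derivative Xs n s) (at s)"
  unfolding X_def Xs_def by (auto intro!: derivative_eq_intros \<gamma> \<nu>)

lemma Xs_has_vector_derivative:
  "((\<lambda>s. Xs n s) has_vector_derivative (\<gamma>2 s + n *\<^sub>R \<nu>2 s)) (at s)"
  unfolding Xs_def by (auto intro!: derivative_eq_intros \<gamma>1 \<nu>1)

lemma continuous_on_X [continuous_intros]:
  assumes "continuous_on A f" "continuous_on A g"
  shows "continuous_on A (\<lambda>x. X (f x) (g x))" "continuous_on A (\<lambda>x. Xs (f x) (g x))"
  unfolding X_def Xs_def using assms by (auto intro!: continuous_intros)

text \<open>The product rule gives an explicit formula \<open>B'\<close> for the derivative in
  \<open>s\<close>. It is visibly continuous and identifies the \<open>deriv\<close> that occurs in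
  the hypothesis on the field.\<close>

lemma field_coeff_C1:
  assumes b: "smooth_on \<Omega> b" and X: "\<And>n s. 0 < n \<Longrightarrow> n < M \<Longrightarrow> X n s \<in> \<Omega>"
  shows "continuous_on ({0<..<M} \<times> UNIV) (\<lambda>(n, s). field_coeff b \<gamma> \<nu> n s)"
    and "continuous_on ({0<..<M} \<times> UNIV) (\<lambda>(n, s). deriv (field_coeff b \<gamma> \<nu> n) s)"
    and "\<And>n s. 0 < n \<Longrightarrow> n < M \<Longrightarrow>
      (field_coeff b \<gamma> \<nu> n has_real_derivative deriv (field_coeff b \<gamma> \<nu> n) s) (at s)"
proof -
  let ?S = "{0<..<M} \<times> (UNIV :: real set)"
  let ?Db = "\<lambda>x. frechet_derivative b (at x)"
  define B' where "B' n s = b (X n s) * (det2 (\<nu> s) (\<gamma>2 s + n *\<^sub>R \<nu>2 s) + det2 (\<nu>1 s) (Xs n s))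
      + ?Db (X n s) (Xs n s) * det2 (\<nu> s) (Xs n s)" for n s
  have cX: "continuous_on ?S (\<lambda>z. X (fst z) (snd z))" "continuous_on ?S (\<lambda>z. Xs (fst z) (snd z))"
    by (intro continuous_intros)+
  have iX: "(\<lambda>z. X (fst z) (snd z)) ` ?S \<subseteq> \<Omega>" using X by auto
  have cb: "continuous_on ?S (\<lambda>z. b (X (fst z) (snd z)))"
    by (rule continuous_on_compose2[OF smooth_on_continuous_on[OF b] cX(1) iX])
  show "continuous_on ?S (\<lambda>(n, s). field_coeff b \<gamma> \<nu> n s)"
    unfolding field_coeff_eq split_beta'
    by (intro continuous_intros cb det2.continuous_on)
  have der: "(field_coeff b \<gamma> \<nu> n has_real_derivative B' n s) (at s)" if n: "0 < n" "n < M" for n s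
  proof -
    have "((\<lambda>s. b (X n s)) has_derivative (\<lambda>h. ?Db (X n s) (h *\<^sub>R Xs n s))) (at s)"
      using has_derivative_compose[OF
          X_has_vector_derivative[of n s, unfolded has_vector_derivative_def]
          smooth_on_has_derivative[OF b X[OF n]]] .
    moreover have "linear (?Db (X n s))"
      using smooth_on_has_derivative[OF b X[OF n]] has_derivative_linear by blast
    ultimately have 1: "((\<lambda>s. b (X n s)) has_real_derivative ?Db (X n s) (Xs n s)) (at s)"
      by (simp add: linear_scale has_field_derivative_def mult.commute[of "?Db _ _"] mult_commute_abs)
    have 2: "((\<lambda>s. det2 (\<nu> s) (Xs n s)) has_real_derivative
        det2 (\<nu> s) (\<gamma>2 s + n *\<^sub>R \<nu>2 s) + det2 (\<nu>1 s) (Xs n s)) (at s)"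
      using det2.has_vector_derivative[OF \<nu> Xs_has_vector_derivative, of n s]
      by (simp add: has_real_derivative_iff_has_vector_derivative)
    show ?thesis
      unfolding field_coeff_eq[abs_def] B'_def
      by (rule DERIV_cong[OF DERIV_mult[OF 1 2]]) (simp add: algebra_simps)
  qed
  then have deriv: "deriv (field_coeff b \<gamma> \<nu> n) s = B' n s" if "0 < n" "n < M" for n s
    using that DERIV_imp_deriv by blast
  have "continuous_on ?S (\<lambda>(n, s). B' n s)"
    unfolding B'_def split_beta'
    by (intro continuous_intros cb det2.continuous_on
        continuous_on_frechet_derivative_apply[OF b cX(1) iX cX(2)])
  then show "continuous_on ?S (\<lambda>(n, s). deriv (field_coeff b \<gamma> \<nu> n) s)"
    by (rule continuous_on_eq) (auto simp: deriv)
  show "(field_coeff b \<gamma> \<nu> n has_real_derivative deriv (field_coeff b \<gamma> \<nu> n) s) (at s)"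
    if "0 < n" "n < M" for n s
    using der[OF that] deriv[OF that] by simp
qed

section \<open>The collar near a boundary point\<close>

text \<open>Inverse function theorem at \<open>(0, s0)\<close>, where the coordinate vectors are
  orthonormal. The resulting coordinates live on a full neighbourhood of the boundary point, across
  \<open>n = 0\<close>, and so have limits along a curve that tends to this point.\<close>

lemma local_coordinates:
  obtains V n s where "open V" "\<gamma> s0 \<in> V" "n (\<gamma> s0) = 0" "s (\<gamma> s0) = s0"
    "\<And>y. y \<in> V \<Longrightarrow> X (n y) (s y) = y"
    "\<And>y. y \<in> V \<Longrightarrow> n differentiable (at y)"
    "\<And>y. y \<in> V \<Longrightarrow> s differentiable (at y)"
proof -
  \<comment> \<open>The pair \<open>(n, s)\<close> is encoded in \<open>real^2\<close>, so that the
    map goes from a space to itself.\<close>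
  define f where "f y = X (y $ 1) (y $ 2)" for y :: "real^2"
  define f' :: "real^2 \<Rightarrow> (real^2) \<Rightarrow>\<^sub>L (real^2)" where
    "f' y = (blinfun_scaleR_left (\<nu> (y $ 2)) o\<^sub>L blinfun_inner_right (axis 1 1))
      + (blinfun_scaleR_left (Xs (y $ 1) (y $ 2)) o\<^sub>L blinfun_inner_right (axis 2 1))" for y
  define y0 :: "real^2" where "y0 = vector [0, s0]"
  \<comment> \<open>As \<open>Xs 0 s0 = \<gamma>1 s0\<close>, the derivative at \<open>y0\<close>
    has orthonormal columns; its inverse is the transpose.\<close>
  define invf :: "(real^2) \<Rightarrow>\<^sub>L (real^2)" where
    "invf = (blinfun_scaleR_left (axis 1 1) o\<^sub>L blinfun_inner_right (\<nu> s0))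
      + (blinfun_scaleR_left (axis 2 1) o\<^sub>L blinfun_inner_right (\<gamma>1 s0))"
  have y0: "y0 $ 1 = 0" "y0 $ 2 = s0" by (auto simp: y0_def)
  have f'_apply: "blinfun_apply (f' y) h = h $ 1 *\<^sub>R \<nu> (y $ 2) + h $ 2 *\<^sub>R Xs (y $ 1) (y $ 2)" for y h :: "real^2"
    by (simp add: f'_def blinfun.add_left inner_axis' )
  obtain U V g g' where V: "open V" "f y0 \<in> V" "y0 \<in> U" and hom: "homeomorphism U V f g"
    and g: "\<And>y. y \<in> V \<Longrightarrow> (g has_derivative (g' y)) (at y)"
  proof (rule inverse_function_theorem[of UNIV f f' y0 invf])
    show "(f has_derivative blinfun_apply (f' y)) (at y)" for y
    proof -
      have p: "((\<lambda>y::real^2. (y $ 1, y $ 2)) has_derivative (\<lambda>h. (h $ 1, h $ 2))) (at y)"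
        by (intro has_derivative_Pair bounded_linear_imp_has_derivative bounded_linear_vec_nth)
      have "((\<lambda>y. normal_coords \<gamma> \<nu> (y $ 1, y $ 2)) has_derivative
          (\<lambda>h. (\<lambda>(dn, ds). dn *\<^sub>R \<nu> (y $ 2) + ds *\<^sub>R Xs (y $ 1) (y $ 2)) (h $ 1, h $ 2))) (at y)"
        by (rule has_derivative_compose[OF p normal_coords_has_derivative])
      moreover have "(\<lambda>y. normal_coords \<gamma> \<nu> (y $ 1, y $ 2)) = f"
        by (simp add: fun_eq_iff normal_coords_def f_def X_def)
      ultimately show ?thesis
        by (simp add: f'_apply[abs_def])
    qed
    show "continuous_on UNIV f'"
      unfolding f'_def by (intro continuous_intros)
    show "invf o\<^sub>L f' y0 = id_blinfun"
      using \<nu>_\<gamma>1[of s0] norm_\<nu>[of s0] norm_\<gamma>1[of s0]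
      by (intro blinfun_eqI)
        (auto simp: f'_apply invf_def y0 Xs_def blinfun.add_left blinfun.add_right blinfun.scaleR_right inner_add_right
          inner_commute vec_eq_iff forall_2 axis_def norm_eq_1)
  qed blast+
  have "f y0 = \<gamma> s0" by (simp add: f_def y0 X_def)
  moreover have "g (f y0) = y0" using hom V(3) by (simp add: homeomorphism_def)
  moreover have "f (g y) = y" if "y \<in> V" for y using hom that by (simp add: homeomorphism_def)
  moreover have "(\<lambda>y. g y $ i) differentiable (at y)" if "y \<in> V" for y i
    using bounded_linear.has_derivative[OF bounded_linear_vec_nth g[OF that]]
    by (auto simp: differentiable_def)
  ultimately show ?thesis
    using V y0 by (intro that[of V "\<lambda>y. g y $ 1" "\<lambda>y. g y $ 2"]) (auto simp: f_def)
qed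

text \<open>A defining function of the boundary has negative derivative along \<open>\<nu>\<close> near \<open>\<gamma> s0\<close>.\<close>

lemma collar_sides:
  assumes \<Omega>: "open \<Omega>" "smooth_boundary \<Omega>" and bd: "range \<gamma> \<subseteq> frontier \<Omega>"
    and inward: "\<exists>\<epsilon>>0. \<forall>n\<in>{0<..<\<epsilon>}. X n s0 \<in> \<Omega>"
  obtains d where "d > 0" "\<And>n s. \<bar>n\<bar> < d \<Longrightarrow> \<bar>s - s0\<bar> < d \<Longrightarrow> X n s \<in> \<Omega> \<Longrightarrow> 0 < n"
proof -
  obtain U \<rho> where U: "open U" "\<gamma> s0 \<in> U" and \<rho>: "smooth_on U \<rho>"
    and regular: "frechet_derivative \<rho> (at (\<gamma> s0)) \<noteq> (\<lambda>v. 0)"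
    and \<Omega>U: "\<Omega> \<inter> U = {x\<in>U. \<rho> x < (0::real)}"
  proof -
    have "\<gamma> s0 \<in> frontier \<Omega>" using bd by auto
    then show ?thesis using \<Omega>(2) that unfolding smooth_boundary_def by blast
  qed
  have neg: "\<rho> x < 0" if "x \<in> \<Omega>" "x \<in> U" for x
    using that \<Omega>U by blast
  let ?D = "\<lambda>x. frechet_derivative \<rho> (at x)"
  have lin: "linear (?D x)" if "x \<in> U" for x
    using smooth_on_has_derivative[OF \<rho> that] has_derivative_linear by blast
  have contX: "continuous_on UNIV (\<lambda>z. X (fst z) (snd z))"
    by (intro continuous_intros)
  have not_\<Omega>: "\<gamma> s \<notin> \<Omega>" for s
    using bd \<Omega>(1) by (auto simp: frontier_def interior_open)
  \<comment> \<open>Boundary points lie outside the open set \<Omega>, whence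
    \<open>\<rho> \<ge> 0\<close>. A positive value would give a neighbourhood that misses \<Omega>,
    although the point is in its closure.\<close>
  have \<rho>0: "\<rho> (\<gamma> s) = 0" if "\<gamma> s \<in> U" for s
  proof (rule antisym)
    show "0 \<le> \<rho> (\<gamma> s)" using that not_\<Omega>[of s] \<Omega>U by force
    show "\<rho> (\<gamma> s) \<le> 0"
    proof (rule ccontr)
      assume "\<not> \<rho> (\<gamma> s) \<le> 0"
      moreover have "open (U \<inter> \<rho> -` {0<..})"
        by (rule continuous_open_preimage[OF smooth_on_continuous_on[OF \<rho>] U(1)]) simp
      moreover have "\<gamma> s \<in> closure \<Omega>" using bd by (auto simp: frontier_def)
      ultimately have "\<Omega> \<inter> (U \<inter> \<rho> -` {0<..}) \<noteq> {}"
        using that open_Int_closure_eq_empty[of "U \<inter> \<rho> -` {0<..}" \<Omega>] by auto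
      then show False using neg by fastforce
    qed
  qed
  have deriv_n: "((\<lambda>n. \<rho> (X n s)) has_real_derivative ?D (X n s) (\<nu> s)) (at n)"
    if "X n s \<in> U" for n s
  proof -
    have "((\<lambda>n. X n s) has_derivative (\<lambda>h. h *\<^sub>R \<nu> s)) (at n)"
      unfolding X_def by (auto intro!: derivative_eq_intros)
    from has_derivative_compose[OF this smooth_on_has_derivative[OF \<rho> that]]
    show ?thesis using lin[OF that]
      by (simp add: linear_scale has_field_derivative_def mult_commute_abs)
  qed
  have tangent: "?D (\<gamma> s0) (\<gamma>1 s0) = 0"
  proof -
    have "((\<lambda>s. \<rho> (\<gamma> s)) has_derivative (\<lambda>h. ?D (\<gamma> s0) (h *\<^sub>R \<gamma>1 s0))) (at s0)"
      using has_derivative_compose[OF \<gamma>[unfolded has_vector_derivative_def]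
          smooth_on_has_derivative[OF \<rho> U(2)]] .
    moreover have "((\<lambda>s. \<rho> (\<gamma> s)) has_derivative (\<lambda>h. 0)) (at s0)"
    proof (rule has_derivative_transform_within_open[OF has_derivative_const])
      show "open (\<gamma> -` U)" using U(1)
        by (intro open_vimage continuous_intros)
      show "s0 \<in> \<gamma> -` U" using U by simp
      show "0 = \<rho> (\<gamma> s)" if "s \<in> \<gamma> -` U" for s using \<rho>0 that by simp
    qed
    ultimately have "(\<lambda>h. ?D (\<gamma> s0) (h *\<^sub>R \<gamma>1 s0)) = (\<lambda>h. 0)" by (rule has_derivative_unique)
    from fun_cong[OF this, of 1] show ?thesis by simp
  qed
  have X0: "X 0 s = \<gamma> s" for s by (simp add: X_def)
  \<comment> \<open>The differential of \<rho> is nonzero but kills the tangent, so it cannot kill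
    \<nu>. A positive value would make \<rho> positive just above the boundary along \<nu>, where
    the points belong to \<Omega>.\<close>
  have normal: "?D (\<gamma> s0) (\<nu> s0) < 0"
  proof -
    have "?D (\<gamma> s0) (\<nu> s0) \<noteq> 0"
    proof
      assume "?D (\<gamma> s0) (\<nu> s0) = 0"
      then have "?D (\<gamma> s0) v = 0" for v
        by (subst orthonormal_expansion_2[OF norm_\<nu> norm_\<gamma>1 \<nu>_\<gamma>1, of v s0])
          (simp add: linear_add[OF lin[OF U(2)]] linear_scale[OF lin[OF U(2)]] tangent)
      then show False using regular by auto
    qed
    moreover have "\<not> ?D (\<gamma> s0) (\<nu> s0) > 0"
    proof
      assume pos: "?D (\<gamma> s0) (\<nu> s0) > 0"
      have "((\<lambda>n. \<rho> (X n s0)) has_real_derivative ?D (\<gamma> s0) (\<nu> s0)) (at 0)"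
        using deriv_n[of 0 s0] U X0 by simp
      from DERIV_pos_inc_right[OF this pos] obtain d where
        d: "d > 0" "\<And>h. h > 0 \<Longrightarrow> h < d \<Longrightarrow> \<rho> (X 0 s0) < \<rho> (X h s0)" by auto
      have "open ((\<lambda>n. X n s0) -` U)" using U(1)
        by (intro open_vimage continuous_intros)
      moreover have "0 \<in> (\<lambda>n. X n s0) -` U" using U X0 by simp
      ultimately obtain d' where "d' > 0" "ball 0 d' \<subseteq> (\<lambda>n. X n s0) -` U"
        by (rule openE)
      then have d': "d' > 0" "\<And>h. \<bar>h\<bar> < d' \<Longrightarrow> X h s0 \<in> U"
        by (auto simp: subset_iff dist_real_def)
      obtain \<epsilon> where \<epsilon>: "\<epsilon> > 0" "\<And>h. h \<in> {0<..<\<epsilon>} \<Longrightarrow> X h s0 \<in> \<Omega>" using inward by blast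
      define h where "h = min d (min d' \<epsilon>) / 2"
      have h: "0 < h" "h < d" "h < d'" "h < \<epsilon>" using d(1) d'(1) \<epsilon>(1) by (auto simp: h_def)
      have "\<rho> (X h s0) < 0" using \<epsilon>(2)[of h] d'(2)[of h] h neg by auto
      then show False using d(2)[of h] h \<rho>0[OF U(2)] X0 by auto
    qed
    ultimately show ?thesis by simp
  qed
  \<comment> \<open>Coordinates at which the point is in \<open>U\<close> and \<rho> still decreases
    along \<nu>. A product neighbourhood of \<open>(0, s0)\<close> inside \<open>W\<close> contains
    whole normal segments through \<open>n = 0\<close>.\<close>
  define W where "W = {z. X (fst z) (snd z) \<in> U} \<inter>
    (\<lambda>z. ?D (X (fst z) (snd z)) (\<nu> (snd z))) -` {..<0}"
  have oU: "open {z. X (fst z) (snd z) \<in> U}"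
    using open_vimage[OF U(1) contX] by (simp add: vimage_def)
  have "open W"
    unfolding W_def
  proof (rule continuous_open_preimage[OF _ oU])
    show "continuous_on {z. X (fst z) (snd z) \<in> U} (\<lambda>z. ?D (X (fst z) (snd z)) (\<nu> (snd z)))"
      by (rule continuous_on_frechet_derivative_apply[OF \<rho>]) (auto intro!: continuous_intros)
  qed simp
  moreover have "(0, s0) \<in> W" using normal U by (simp add: W_def X0)
  ultimately obtain A A' where A: "open A" "open A'" "(0, s0) \<in> A \<times> A'" "A \<times> A' \<subseteq> W"
    by (rule open_prod_elim)
  then have "0 \<in> A" "s0 \<in> A'" by auto
  obtain d1 where "d1 > 0" "ball 0 d1 \<subseteq> A" using openE[OF A(1) \<open>0 \<in> A\<close>] .
  then have d1: "d1 > 0" "\<And>n. \<bar>n\<bar> < d1 \<Longrightarrow> n \<in> A"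
    by (auto simp: subset_iff dist_real_def)
  obtain d2 where "d2 > 0" "ball s0 d2 \<subseteq> A'" using openE[OF A(2) \<open>s0 \<in> A'\<close>] .
  then have d2: "d2 > 0" "\<And>s. \<bar>s - s0\<bar> < d2 \<Longrightarrow> s \<in> A'"
    by (auto simp: subset_iff dist_real_def abs_minus_commute)
  show ?thesis
  proof (rule that[of "min d1 d2"])
    show "0 < min d1 d2" using d1 d2 by simp
    fix n s assume n: "\<bar>n\<bar> < min d1 d2" and s: "\<bar>s - s0\<bar> < min d1 d2" and X: "X n s \<in> \<Omega>"
    have inW: "(x, s) \<in> W" if "\<bar>x\<bar> < min d1 d2" for x using that s d1 d2 A(4) by auto
    show "0 < n"
    proof (rule ccontr)
      assume "\<not> 0 < n"
      \<comment> \<open>The value \<open>n = 0\<close> would be a boundary point. For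
        \<open>n < 0\<close>, monotonicity along the normal segment up to 0 makes
        \<open>\<rho> (X n s)\<close> positive, which is impossible in \<Omega>.\<close>
      then have "n < 0" using X not_\<Omega>[of s] X0 by (cases "n = 0") auto
      then have "\<rho> (X 0 s) < \<rho> (X n s)"
      proof (rule DERIV_neg_imp_decreasing)
        fix x assume "n \<le> x" "x \<le> 0"
        then have "(x, s) \<in> W" using n by (intro inW) auto
        then show "\<exists>y. ((\<lambda>n. \<rho> (X n s)) has_real_derivative y) (at x) \<and> y < 0"
          using deriv_n[of x s] by (auto simp: W_def)
      qed
      moreover have "\<rho> (X 0 s) = 0" using \<rho>0[of s] inW[of 0] d1 d2 by (simp add: W_def X0)
      moreover have "X n s \<in> U" using inW[OF n] by (simp add: W_def)
      ultimately show False using X neg[of "X n s"] by auto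
    qed
  qed
qed

section \<open>Motion in normal coordinates and the canonical momentum\<close>

lemma X_curve_derivative:
  assumes n: "(n has_real_derivative dn) (at t)" and s: "(s has_real_derivative ds) (at t)"
  shows "((\<lambda>t. X (n t) (s t)) has_vector_derivative dn *\<^sub>R \<nu> (s t) + ds *\<^sub>R Xs (n t) (s t)) (at t)"
    and "((\<lambda>t. Xs (n t) (s t)) has_vector_derivative
          dn *\<^sub>R \<nu>1 (s t) + ds *\<^sub>R (\<gamma>2 (s t) + n t *\<^sub>R \<nu>2 (s t))) (at t)"
proof -
  note chain = vector_diff_chain_at[OF s[unfolded has_real_derivative_iff_has_vector_derivative], unfolded o_def]
  show "((\<lambda>t. X (n t) (s t)) has_vector_derivative dn *\<^sub>R \<nu> (s t) + ds *\<^sub>R Xs (n t) (s t)) (at t)"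
    unfolding X_def Xs_def
    by (rule derivative_eq_intros chain[OF \<gamma>] chain[OF \<nu>] n refl)+ (simp add: algebra_simps)
  show "((\<lambda>t. Xs (n t) (s t)) has_vector_derivative
          dn *\<^sub>R \<nu>1 (s t) + ds *\<^sub>R (\<gamma>2 (s t) + n t *\<^sub>R \<nu>2 (s t))) (at t)"
    unfolding Xs_def
    by (rule derivative_eq_intros chain[OF \<gamma>1] chain[OF \<nu>1] n refl)+ (simp add: algebra_simps)
qed

lemma frame_bounded:
  obtains K where "K \<ge> 0"
    "\<And>s. \<bar>s - s0\<bar> \<le> 1 \<Longrightarrow> norm (\<nu>1 s) \<le> K \<and> norm (\<gamma>2 s) \<le> K \<and> norm (\<nu>2 s) \<le> K"
proof -
  define f where "f s = norm (\<nu>1 s) + norm (\<gamma>2 s) + norm (\<nu>2 s)" for s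
  have "continuous_on {s0 - 1..s0 + 1} f"
    unfolding f_def by (intro continuous_intros)
  then obtain K where K: "\<And>s. s \<in> {s0 - 1..s0 + 1} \<Longrightarrow> norm (f s) \<le> K"
    using compact_imp_bounded[OF compact_continuous_image] compact_Icc by (metis bounded_iff imageI)
  have *: "norm (\<nu>1 s) \<le> K \<and> norm (\<gamma>2 s) \<le> K \<and> norm (\<nu>2 s) \<le> K" if "\<bar>s - s0\<bar> \<le> 1" for s
  proof -
    have "f s \<le> K" using K[of s] that by (auto simp: abs_le_iff)
    moreover have "norm (\<nu>1 s) \<ge> 0" "norm (\<gamma>2 s) \<ge> 0" "norm (\<nu>2 s) \<ge> 0" by auto
    ultimately show ?thesis unfolding f_def by linarith
  qed
  moreover have "K \<ge> 0" using *[of s0] order_trans[OF norm_ge_zero] by auto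
  ultimately show ?thesis using that by blast
qed

text \<open>The momentum argument for a trajectory given by its coordinate functions on a final time
  interval. The positivity of \<open>n\<close> ensures that zero is approached from the side where
  the field integral diverges.\<close>

lemma no_collision:
  assumes collar: "magnetic_collar (field_coeff b \<gamma> \<nu>) (\<lambda>u. deriv (field_coeff b \<gamma> \<nu> u)) M N D"
    and m: "m > 0" and e: "e \<noteq> 0" and "t0 < T"
    and q: "\<And>t. t0 < t \<Longrightarrow> t < T \<Longrightarrow> (q has_vector_derivative v t) (at t)"
    and v: "\<And>t. t0 < t \<Longrightarrow> t < T \<Longrightarrow> (v has_vector_derivative a t) (at t)"
    and newton: "\<And>t. t0 < t \<Longrightarrow> t < T \<Longrightarrow> m *\<^sub>R a t = - (e * b (q t)) *\<^sub>R (J *v v t)"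
    and coords: "\<And>t. t0 < t \<Longrightarrow> t < T \<Longrightarrow> q t = X (n t) (s t)"
    and n_pos: "\<And>t. t0 < t \<Longrightarrow> t < T \<Longrightarrow> 0 < n t"
    and n: "\<And>t. t0 < t \<Longrightarrow> t < T \<Longrightarrow> n differentiable (at t)"
    and s: "\<And>t. t0 < t \<Longrightarrow> t < T \<Longrightarrow> s differentiable (at t)"
    and lim: "(n \<longlongrightarrow> 0) (at_left T)" "(s \<longlongrightarrow> s0) (at_left T)"
    and blowup: "filterlim (\<lambda>n. \<bar>integral {n..N} (\<lambda>u. field_coeff b \<gamma> \<nu> u s0)\<bar>) at_top (at_right 0)"
  shows False
proof -
  interpret magnetic_collar "field_coeff b \<gamma> \<nu>" "\<lambda>u. deriv (field_coeff b \<gamma> \<nu> u)" M N D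
    by (rule collar)
  obtain K where K: "K \<ge> 0"
    "\<And>s. \<bar>s - s0\<bar> \<le> 1 \<Longrightarrow> norm (\<nu>1 s) \<le> K \<and> norm (\<gamma>2 s) \<le> K \<and> norm (\<nu>2 s) \<le> K"
    using frame_bounded[of s0] by blast
  define n' where "n' t = deriv n t" for t
  define s' where "s' t = deriv s t" for t
  have n': "(n has_real_derivative n' t) (at t)" and s': "(s has_real_derivative s' t) (at t)"
    if "t0 < t" "t < T" for t
    using n[OF that] s[OF that] by (simp_all add: n'_def s'_def DERIV_deriv_iff_real_differentiable)
  have "\<forall>\<^sub>F t in at_left T. t0 < t"
    using \<open>t0 < T\<close> by (auto simp: eventually_at_left_field)
  \<comment> \<open>The threshold \<open>N\<close> keeps \<open>n\<close> where \<open>H\<close> is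
    differentiable, 1 bounds the term \<open>n t *\<^sub>R \<nu>2 (s t)\<close>, and the last one
    gives \<open>n t * K \<le> 1 / 2\<close>, with \<open>K + 1\<close> in place of \<open>K\<close>
    to avoid division by zero.\<close>
  then have "\<forall>\<^sub>F t in at_left T. t0 < t \<and> n t < min N (min 1 (1 / (2 * (K + 1)))) \<and> dist (s t) s0 < 1"
    using order_tendstoD(2)[OF lim(1), of "min N (min 1 (1 / (2 * (K + 1))))"] N K(1)
      tendstoD[OF lim(2), of 1]
    by (intro eventually_conj) simp_all
  then obtain t1 where t1: "t1 < T"
    and near: "\<And>t. t1 < t \<Longrightarrow> t < T \<Longrightarrow> t0 < t \<and> n t < N \<and> n t < 1 \<and> n t < 1 / (2 * (K + 1)) \<and> \<bar>s t - s0\<bar> < 1"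
    using eventually_at_left[OF \<open>t0 < T\<close>] by (auto simp: dist_real_def)
  \<comment> \<open>Starting strictly after \<open>t1\<close> lets \<open>I\<close> contain its
    initial time, the reference point for the change of momentum.\<close>
  define t2 where "t2 = (t1 + T) / 2"
  define I where "I = {t2..<T}"
  have I: "t0 < t" "t < T" "n t < N" "n t < 1" "n t * K \<le> 1 / 2" "\<bar>s t - s0\<bar> \<le> 1" "0 < n t"
    if "t \<in> I" for t
  proof -
    have t: "t1 < t" "t < T" using that t1 by (auto simp: I_def t2_def)
    from near[OF this] n_pos t
    show *: "t0 < t" "t < T" "n t < N" "n t < 1" "\<bar>s t - s0\<bar> \<le> 1" "0 < n t" by auto
    have "n t * K \<le> n t * (K + 1)" using * by (simp add: algebra_simps)
    also have "\<dots> \<le> 1 / (2 * (K + 1)) * (K + 1)"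
      using near[OF t] K(1) by (intro mult_right_mono) auto
    also have "\<dots> = 1 / 2" using K(1) by simp
    finally show "n t * K \<le> 1 / 2" .
  qed
  have t2: "t2 \<in> I" "t2 < T" using t1 by (auto simp: I_def t2_def)
  have "convex I" by (simp add: I_def)
  note bounds = K(2)[OF I(6)]

  have v_eq: "v t = n' t *\<^sub>R \<nu> (s t) + s' t *\<^sub>R Xs (n t) (s t)" if "t \<in> I" for t
  proof -
    note t = I(1,2)[OF that]
    have "(q has_vector_derivative n' t *\<^sub>R \<nu> (s t) + s' t *\<^sub>R Xs (n t) (s t)) (at t)"
      by (rule has_vector_derivative_transform_within_open
          [OF X_curve_derivative(1)[OF n'[OF t] s'[OF t]], of "{t0<..<T}"])
        (use t coords in auto)
    with q[OF t] show ?thesis by (rule vector_derivative_unique_at)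
  qed
  have a_inner: "m * (a t \<bullet> w) = - (e * b (q t)) * det2 (v t) w" if "t \<in> I" for t w
    using arg_cong[OF newton[OF I(1,2)[OF that]], of "\<lambda>x. x \<bullet> w"] by (simp add: J_inner)
  \<comment> \<open>The magnetic force is orthogonal to the velocity, because the area form vanishes
    on equal arguments.\<close>
  obtain c where speed: "\<And>t. t \<in> I \<Longrightarrow> norm (v t) = c"
  proof -
    have "((\<lambda>t. v t \<bullet> v t) has_field_derivative 0) (at t within I)" if "t \<in> I" for t
    proof -
      have "((\<lambda>t. v t \<bullet> v t) has_vector_derivative v t \<bullet> a t + a t \<bullet> v t) (at t)"
        by (rule bounded_bilinear.has_vector_derivative[OF bounded_bilinear_inner])
          (rule v[OF I(1,2)[OF that]])+
      moreover have "a t \<bullet> v t = 0" using a_inner[OF that, of "v t"] m by simp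
      ultimately show ?thesis
        by (auto simp: has_real_derivative_iff_has_vector_derivative inner_commute
            intro: has_vector_derivative_at_within)
    qed
    from has_field_derivative_zero_constant[OF \<open>convex I\<close> this]
    obtain c where "\<And>t. t \<in> I \<Longrightarrow> v t \<bullet> v t = c" by auto
    then show ?thesis using that[of "sqrt c"] by (simp add: norm_eq_sqrt_inner)
  qed
  have c: "c \<ge> 0" using speed[OF t2(1)] by auto
  have n'_bound: "\<bar>n' t\<bar> \<le> c" if "t \<in> I" for t
  proof -
    have "v t \<bullet> \<nu> (s t) = n' t"
      using \<nu>_Xs[of "s t" "n t"] norm_\<nu>[of "s t"]
      by (simp add: v_eq[OF that] inner_add_right inner_add_left inner_commute norm_eq_1)
    then show ?thesis using Cauchy_Schwarz_ineq2[of "v t" "\<nu> (s t)"] speed[OF that] norm_\<nu> by simp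
  qed
  \<comment> \<open>The tangential component of \<open>Xs\<close> is
    \<open>1 + n t * (\<nu>1 (s t) \<bullet> \<gamma>1 (s t))\<close>, of absolute value at least
    1/2; hence the factor 2.\<close>
  have s'_bound: "\<bar>s' t\<bar> \<le> 2 * c" if "t \<in> I" for t
  proof -
    have eq: "v t \<bullet> \<gamma>1 (s t) = s' t * (1 + n t * (\<nu>1 (s t) \<bullet> \<gamma>1 (s t)))"
      using \<nu>_\<gamma>1[of "s t"] norm_\<gamma>1[of "s t"]
      by (simp add: v_eq[OF that] inner_add_left Xs_def norm_eq_1)
    have "\<bar>n t * (\<nu>1 (s t) \<bullet> \<gamma>1 (s t))\<bar> \<le> n t * K"
      using Cauchy_Schwarz_ineq2[of "\<nu>1 (s t)" "\<gamma>1 (s t)"] norm_\<gamma>1[of "s t"] bounds[OF that] I(7)[OF that]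
      by (auto simp: abs_mult)
    then have "1 / 2 \<le> \<bar>1 + n t * (\<nu>1 (s t) \<bullet> \<gamma>1 (s t))\<bar>" using I(5)[OF that] by linarith
    then have "\<bar>s' t\<bar> * (1 / 2) \<le> \<bar>v t \<bullet> \<gamma>1 (s t)\<bar>"
      unfolding eq abs_mult by (rule mult_left_mono) simp
    also have "\<dots> \<le> c"
      using Cauchy_Schwarz_ineq2[of "v t" "\<gamma>1 (s t)"] speed[OF that] norm_\<gamma>1 by simp
    finally show ?thesis by simp
  qed

  \<comment> \<open>The derivative of \<open>Xs (n t) (s t)\<close> along the trajectory. In its
    bound, 5 is the sum of 1 from the \<nu>1 term and \<open>2 * 2\<close> from the other
    one.\<close>
  define w where "w t = n' t *\<^sub>R \<nu>1 (s t) + s' t *\<^sub>R (\<gamma>2 (s t) + n t *\<^sub>R \<nu>2 (s t))" for t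
  have w_bound: "norm (w t) \<le> 5 * c * K" if "t \<in> I" for t
  proof -
    have "norm (n t *\<^sub>R \<nu>2 (s t)) \<le> 1 * K"
      unfolding norm_scaleR using I(4,7)[OF that] bounds[OF that] by (intro mult_mono) auto
    then have "norm (\<gamma>2 (s t) + n t *\<^sub>R \<nu>2 (s t)) \<le> 2 * K"
      using bounds[OF that] norm_triangle_ineq[of "\<gamma>2 (s t)" "n t *\<^sub>R \<nu>2 (s t)"] by linarith
    then have "norm (s' t *\<^sub>R (\<gamma>2 (s t) + n t *\<^sub>R \<nu>2 (s t))) \<le> (2 * c) * (2 * K)"
      unfolding norm_scaleR using s'_bound[OF that] c by (intro mult_mono) auto
    moreover have "norm (n' t *\<^sub>R \<nu>1 (s t)) \<le> c * K"
      unfolding norm_scaleR using n'_bound[OF that] bounds[OF that] c by (intro mult_mono) auto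
    ultimately show ?thesis
      unfolding w_def by (intro order_trans[OF norm_triangle_ineq]) linarith
  qed

  define \<Phi> where "\<Phi> t = m * (v t \<bullet> Xs (n t) (s t)) - e * H (n t) (s t)" for t
  have \<Phi>_deriv: "(\<Phi> has_real_derivative m * (v t \<bullet> w t) - e * (H' (n t) (s t) * s' t)) (at t)"
    if "t \<in> I" for t
  proof -
    note t = I(1,2)[OF that]
    let ?B = "field_coeff b \<gamma> \<nu> (n t) (s t)"
    have "((\<lambda>t. (s t, n t)) has_derivative (\<lambda>h. (s' t * h, n' t * h))) (at t)"
      using n'[OF t] s'[OF t] by (auto simp: has_field_derivative_def intro!: has_derivative_Pair)
    from has_derivative_compose[OF this H_has_derivative[OF I(7,3)[OF that]]]
    have "((\<lambda>t. H (n t) (s t)) has_derivative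
        (\<lambda>h. (H' (n t) (s t) * s' t - ?B * n' t) * h)) (at t)"
      by (simp add: algebra_simps)
    then have H: "((\<lambda>t. H (n t) (s t)) has_real_derivative H' (n t) (s t) * s' t - ?B * n' t) (at t)"
      unfolding has_field_derivative_def .
    have "((\<lambda>t. v t \<bullet> Xs (n t) (s t)) has_vector_derivative
        v t \<bullet> w t + a t \<bullet> Xs (n t) (s t)) (at t)"
      unfolding w_def
      by (rule bounded_bilinear.has_vector_derivative[OF bounded_bilinear_inner v[OF t]
            X_curve_derivative(2)[OF n'[OF t] s'[OF t]]])
    then have P: "((\<lambda>t. v t \<bullet> Xs (n t) (s t)) has_real_derivative
        v t \<bullet> w t + a t \<bullet> Xs (n t) (s t)) (at t)"
      by (simp add: has_real_derivative_iff_has_vector_derivative)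
    \<comment> \<open>Against \<open>Xs\<close>, the part of the velocity along \<open>Xs\<close>
      drops out of the area form. What remains is \<open>n' t\<close> times the field coefficient,
      exactly the term that the derivative of \<open>H\<close> in \<open>n\<close> cancels.\<close>
    have "m * (a t \<bullet> Xs (n t) (s t)) = - e * (?B * n' t)"
      by (simp add: a_inner[OF that] field_coeff_eq coords[OF t] v_eq[OF that]
          det2.add_left det2.scaleR_left)
    then have eq: "m * (v t \<bullet> w t + a t \<bullet> Xs (n t) (s t)) - e * (H' (n t) (s t) * s' t - ?B * n' t)
        = m * (v t \<bullet> w t) - e * (H' (n t) (s t) * s' t)"
      by (simp add: algebra_simps)
    show ?thesis
      using DERIV_diff[OF DERIV_cmult[OF P, of m] DERIV_cmult[OF H, of e]]
      unfolding \<Phi>_def[abs_def] eq .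
  qed
  define R where "R = m * (c * (5 * c * K)) + \<bar>e\<bar> * (D * (2 * c))"
  have \<Phi>_deriv_bound: "norm (m * (v t \<bullet> w t) - e * (H' (n t) (s t) * s' t)) \<le> R" if "t \<in> I" for t
  proof -
    have D: "D \<ge> 0" using H'_bound[OF I(7)[OF that], of 0] by simp
    have "\<bar>v t \<bullet> w t\<bar> \<le> norm (v t) * norm (w t)" by (rule Cauchy_Schwarz_ineq2)
    also have "\<dots> \<le> c * (5 * c * K)"
      using speed[OF that] w_bound[OF that] c by (intro mult_mono) auto
    finally have "\<bar>m * (v t \<bullet> w t)\<bar> \<le> m * (c * (5 * c * K))"
      using m by (simp add: abs_mult)
    moreover have "\<bar>e * (H' (n t) (s t) * s' t)\<bar> \<le> \<bar>e\<bar> * (D * (2 * c))"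
      unfolding abs_mult
      using H'_bound[OF I(7)[OF that]] s'_bound[OF that] D by (intro mult_mono) auto
    ultimately show ?thesis unfolding R_def real_norm_def by linarith
  qed
  have R: "R \<ge> 0" using order_trans[OF norm_ge_zero \<Phi>_deriv_bound[OF t2(1)]] .
  \<comment> \<open>Solving the definition of \<Phi> for \<open>H\<close>: the first two terms bound
    \<Phi> by the mean value inequality, and the last bounds the kinetic part, as \<open>Xs\<close>
    has norm at most \<open>1 + 1 / 2\<close>, hence at most 2.\<close>
  define Q where "Q = (\<bar>\<Phi> t2\<bar> + R * (T - t2) + m * (c * 2)) / \<bar>e\<bar>"
  have H_bound: "\<bar>H (n t) s0\<bar> \<le> Q + D" if "t \<in> I" for t
  proof -
    have "norm (\<Phi> t - \<Phi> t2) \<le> R * norm (t - t2)"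
      by (rule field_differentiable_bound[OF \<open>convex I\<close>
            has_field_derivative_at_within[OF \<Phi>_deriv] \<Phi>_deriv_bound that t2(1)])
    also have "\<dots> \<le> R * (T - t2)" using R that by (intro mult_left_mono) (auto simp: I_def)
    finally have 1: "\<bar>\<Phi> t\<bar> \<le> \<bar>\<Phi> t2\<bar> + R * (T - t2)" by (simp add: abs_le_iff) linarith
    have "norm (n t *\<^sub>R \<nu>1 (s t)) \<le> n t * K"
      using bounds[OF that] I(7)[OF that] by (simp add: mult_left_mono)
    then have "norm (Xs (n t) (s t)) \<le> 2"
      unfolding Xs_def using I(5)[OF that] norm_\<gamma>1[of "s t"]
        norm_triangle_ineq[of "\<gamma>1 (s t)" "n t *\<^sub>R \<nu>1 (s t)"] by linarith
    then have "\<bar>v t \<bullet> Xs (n t) (s t)\<bar> \<le> c * 2"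
      using speed[OF that] c
      by (intro order_trans[OF Cauchy_Schwarz_ineq2] mult_mono) auto
    then have 2: "\<bar>m * (v t \<bullet> Xs (n t) (s t))\<bar> \<le> m * (c * 2)" using m by (simp add: abs_mult)
    have "\<bar>e\<bar> * \<bar>H (n t) (s t)\<bar> = \<bar>m * (v t \<bullet> Xs (n t) (s t)) - \<Phi> t\<bar>"
      unfolding \<Phi>_def by (simp add: abs_mult)
    also have "\<dots> \<le> Q * \<bar>e\<bar>"
      using 1 2 e by (simp add: Q_def)
    finally have "\<bar>H (n t) (s t)\<bar> \<le> Q" using e by (simp add: mult.commute)
    \<comment> \<open>Divergence is known for each fixed \<open>s\<close> only, so the bound is
      moved from \<open>s t\<close> to \<open>s0\<close>; the distance is at most 1.\<close>
    moreover have "\<bar>H (n t) s0 - H (n t) (s t)\<bar> \<le> D"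
    proof -
      have "D \<ge> 0" using H'_bound[OF I(7)[OF that], of 0] by simp
      then have "D * \<bar>s0 - s t\<bar> \<le> D * 1" using I(6)[OF that] by (intro mult_left_mono) auto
      then show ?thesis using H_Lipschitz[OF I(7)[OF that], of s0 "s t"] by linarith
    qed
    ultimately show ?thesis by linarith
  qed
  have ev: "\<forall>\<^sub>F t in at_left T. t \<in> I"
    using t2(2) by (auto simp: I_def eventually_at_left_field)
  have "filterlim n (at_right 0) (at_left T)"
    by (rule tendsto_imp_filterlim_at_right[OF lim(1)]) (use eventually_mono[OF ev I(7)] in simp)
  from filterlim_compose[OF blowup this]
  have "\<forall>\<^sub>F t in at_left T. Q + D < \<bar>H (n t) s0\<bar>"
    unfolding H_def filterlim_at_top_dense by auto
  with ev have "\<forall>\<^sub>F t in at_left T. False"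
  proof eventually_elim
    case (elim t)
    then show False using H_bound[of t] by linarith
  qed
  then show False by simp
qed

end

section \<open>From the hypotheses of the theorem to a framed collar\<close>

text \<open>The normal \<open>\<nu>\<close> inherits its regularity from the normal coordinates, because
  \<open>\<nu> s\<close> is proportional to \<open>x (M/2, s) - \<gamma> s\<close>.\<close>

lemma normal_frame_exists:
  assumes \<gamma>: "arc_length_param C L \<gamma>" and \<nu>: "inward_unit_normal \<Omega> \<gamma> \<nu>"
    and "M > 0" and x: "periodic_diffeo_into \<Omega> M L (normal_coords \<gamma> \<nu>)"
  obtains \<gamma>1 \<gamma>2 \<nu>1 \<nu>2 where "normal_frame \<gamma> \<gamma>1 \<gamma>2 \<nu> \<nu>1 \<nu>2"
proof -
  have "smooth_on UNIV \<gamma>" using \<gamma> by (simp add: arc_length_param_def)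
  from smooth_on_line_C2[OF this, of 0 1] obtain \<gamma>1 \<gamma>2 where
    g: "\<And>s. (\<gamma> has_vector_derivative \<gamma>1 s) (at s)"
    "\<And>s. (\<gamma>1 has_vector_derivative \<gamma>2 s) (at s)" "continuous_on UNIV \<gamma>2"
    by auto
  have "smooth_on ({0<..<M} \<times> UNIV) (normal_coords \<gamma> \<nu>)"
    using x by (simp add: periodic_diffeo_into_def Let_def)
  from smooth_on_line_C2[OF this, of "(M/2, 0)" "(0, 1)"] obtain x1 x2 where
    x1: "\<And>s. ((\<lambda>s. \<gamma> s + (M/2) *\<^sub>R \<nu> s) has_vector_derivative x1 s) (at s)"
    and x2: "\<And>s. (x1 has_vector_derivative x2 s) (at s)" and cx2: "continuous_on UNIV x2"
    using \<open>M > 0\<close> by (auto simp: normal_coords_def)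
  have \<nu>_eq: "(\<lambda>s. (2/M) *\<^sub>R ((\<gamma> s + (M/2) *\<^sub>R \<nu> s) - \<gamma> s)) = \<nu>"
    using \<open>M > 0\<close> by (simp add: fun_eq_iff)
  have "normal_frame \<gamma> \<gamma>1 \<gamma>2 \<nu> (\<lambda>s. (2/M) *\<^sub>R (x1 s - \<gamma>1 s)) (\<lambda>s. (2/M) *\<^sub>R (x2 s - \<gamma>2 s))"
  proof
    show "(\<nu> has_vector_derivative (2/M) *\<^sub>R (x1 s - \<gamma>1 s)) (at s)" for s
      using bounded_linear.has_vector_derivative[OF bounded_linear_scaleR_right
          has_vector_derivative_diff[OF x1 g(1)], of "2/M" s] unfolding \<nu>_eq .
    show "((\<lambda>s. (2/M) *\<^sub>R (x1 s - \<gamma>1 s)) has_vector_derivative (2/M) *\<^sub>R (x2 s - \<gamma>2 s)) (at s)" for s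
      by (auto intro!: derivative_eq_intros x2 g)
    show "continuous_on UNIV (\<lambda>s. (2/M) *\<^sub>R (x2 s - \<gamma>2 s))"
      by (intro continuous_intros cx2 g)
    have "vector_derivative \<gamma> (at s) = \<gamma>1 s" for s by (rule vector_derivative_at[OF g(1)])
    then show "norm (\<gamma>1 s) = 1" "norm (\<nu> s) = 1" "\<nu> s \<bullet> \<gamma>1 s = 0" for s
      using \<gamma> \<nu> by (auto simp: arc_length_param_def inward_unit_normal_def)
  qed (rule g)+
  then show ?thesis by (rule that)
qed

theorem theorem1:
  fixes m e N :: real
    and \<Omega> :: "(real^2) set"
    and b :: "real^2 \<Rightarrow> real"
    and L :: "(real^2) set \<Rightarrow> real"
    and \<gamma> \<nu> :: "(real^2) set \<Rightarrow> real \<Rightarrow> real^2"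
  assumes "m > 0" and "e \<noteq> 0"
    and "open \<Omega>" and "connected \<Omega>" and "bounded \<Omega>" and "smooth_boundary \<Omega>"
    and "smooth_on \<Omega> b"
    and "\<And>C. C \<in> components (frontier \<Omega>) \<Longrightarrow> arc_length_param C (L C) (\<gamma> C)"
    and "\<And>C. C \<in> components (frontier \<Omega>) \<Longrightarrow> inward_unit_normal \<Omega> (\<gamma> C) (\<nu> C)"
    and "N > 0"
    and "\<And>C. C \<in> components (frontier \<Omega>) \<Longrightarrow>
           \<exists>N'>N. periodic_diffeo_into \<Omega> N' (L C) (normal_coords (\<gamma> C) (\<nu> C))"
    and "\<And>C s. C \<in> components (frontier \<Omega>) \<Longrightarrow>
           filterlim (\<lambda>n. \<bar>integral {n..N} (\<lambda>u. field_coeff b (\<gamma> C) (\<nu> C) u s)\<bar>)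
             at_top (at_right 0)"
    and "\<And>C. C \<in> components (frontier \<Omega>) \<Longrightarrow>
           \<exists>D::real. (SUP s. \<integral>\<^sup>+u\<in>{0<..<N}.
               ennreal \<bar>deriv (\<lambda>s'. field_coeff b (\<gamma> C) (\<nu> C) u s') s\<bar> \<partial>lborel) < ennreal D"
  shows "\<not> (\<exists>T>0. \<exists>q. magnetic_trajectory m e b \<Omega> T q \<and>
              (\<exists>p\<in>frontier \<Omega>. (q \<longlongrightarrow> p) (at_left T)))"
proof (intro notI, elim exE conjE bexE)
  fix T q p
  assume T: "T > 0" and traj: "magnetic_trajectory m e b \<Omega> T q"
    and p: "p \<in> frontier \<Omega>" and lim: "(q \<longlongrightarrow> p) (at_left T)"
  define C where "C = connected_component_set (frontier \<Omega>) p"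
  have C: "C \<in> components (frontier \<Omega>)" unfolding C_def by (rule componentsI[OF p])
  obtain M where M: "M > N" "periodic_diffeo_into \<Omega> M (L C) (normal_coords (\<gamma> C) (\<nu> C))"
    using assms(11)[OF C] by blast
  have "M > 0" using M assms(10) by simp
  from normal_frame_exists[OF assms(8,9)[OF C] this M(2)] obtain \<gamma>1 \<gamma>2 \<nu>1 \<nu>2 where
    "normal_frame (\<gamma> C) \<gamma>1 \<gamma>2 (\<nu> C) \<nu>1 \<nu>2" .
  then interpret normal_frame "\<gamma> C" \<gamma>1 \<gamma>2 "\<nu> C" \<nu>1 \<nu>2 .
  have range: "range (\<gamma> C) = C" using assms(8)[OF C] by (simp add: arc_length_param_def)
  moreover have "p \<in> C" using p by (simp add: C_def)
  ultimately obtain s0 where s0: "p = \<gamma> C s0" by auto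
  have X_in: "X n s \<in> \<Omega>" if "0 < n" "n < M" for n s
  proof -
    have "normal_coords (\<gamma> C) (\<nu> C) ` ({0<..<M} \<times> UNIV) \<subseteq> \<Omega>"
      using M(2) by (simp add: periodic_diffeo_into_def Let_def)
    then have "normal_coords (\<gamma> C) (\<nu> C) (n, s) \<in> \<Omega>"
      by (rule subsetD[OF _ imageI]) (use that in simp)
    then show ?thesis by (simp add: X_def normal_coords_def)
  qed
  obtain D where D: "(SUP s. \<integral>\<^sup>+u\<in>{0<..<N}.
      ennreal \<bar>deriv (\<lambda>s'. field_coeff b (\<gamma> C) (\<nu> C) u s') s\<bar> \<partial>lborel) < ennreal D"
    using assms(13)[OF C] by blast
  note C1 = field_coeff_C1[OF \<open>smooth_on \<Omega> b\<close> X_in]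
  have collar: "magnetic_collar (field_coeff b (\<gamma> C) (\<nu> C))
      (\<lambda>u. deriv (field_coeff b (\<gamma> C) (\<nu> C) u)) M N D"
    by unfold_locales (use C1 D M assms(10) in auto)
  obtain V n s where V: "open V" "p \<in> V" and ns0: "n p = 0" "s p = s0"
    and X: "\<And>y. y \<in> V \<Longrightarrow> X (n y) (s y) = y"
    and n: "\<And>y. y \<in> V \<Longrightarrow> n differentiable (at y)"
    and s: "\<And>y. y \<in> V \<Longrightarrow> s differentiable (at y)"
    using local_coordinates[of s0] unfolding s0[symmetric] by blast
  \<comment> \<open>The local inverse does not determine the sign of \<open>n\<close>. That the
    trajectory stays in \<Omega> does, once it is close enough to \<open>p\<close>.\<close>
  have "range (\<gamma> C) \<subseteq> frontier \<Omega>"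
    using in_components_subset[OF C] range by simp
  moreover have "\<exists>\<epsilon>>0. \<forall>n\<in>{0<..<\<epsilon>}. X n s0 \<in> \<Omega>"
    using assms(9)[OF C] by (auto simp: inward_unit_normal_def X_def)
  ultimately obtain d where d: "d > 0"
    and sides: "\<And>n s. \<bar>n\<bar> < d \<Longrightarrow> \<bar>s - s0\<bar> < d \<Longrightarrow> X n s \<in> \<Omega> \<Longrightarrow> 0 < n"
    using collar_sides[OF assms(3,6)] by metis
  have nq: "((\<lambda>t. n (q t)) \<longlongrightarrow> 0) (at_left T)"
    using isCont_tendsto_compose[OF differentiable_imp_continuous_within[OF n[OF V(2)]] lim] ns0 by simp
  have sq: "((\<lambda>t. s (q t)) \<longlongrightarrow> s0) (at_left T)"
    using isCont_tendsto_compose[OF differentiable_imp_continuous_within[OF s[OF V(2)]] lim] ns0 by simp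
  \<comment> \<open>Positive times are interior to \<open>{0..<T}\<close>, where the one-sided
    derivatives of the equations of motion become two-sided.\<close>
  have "\<forall>\<^sub>F t in at_left T. 0 < t"
    using T by (auto simp: eventually_at_left_field)
  then have "\<forall>\<^sub>F t in at_left T. 0 < t \<and> q t \<in> V \<and> dist (n (q t)) 0 < d \<and> dist (s (q t)) s0 < d"
    using topological_tendstoD[OF lim V] tendstoD[OF nq d] tendstoD[OF sq d]
    by (intro eventually_conj) simp_all
  then obtain t0 where t0: "t0 < T"
    and near: "\<And>t. t0 < t \<Longrightarrow> t < T \<Longrightarrow> 0 < t \<and> q t \<in> V \<and> \<bar>n (q t)\<bar> < d \<and> \<bar>s (q t) - s0\<bar> < d"
    using eventually_at_left[OF T] by (auto simp: dist_real_def)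
  obtain v a where va: "\<And>t. t \<in> {0..<T} \<Longrightarrow> q t \<in> \<Omega> \<and>
        (q has_vector_derivative v t) (at t within {0..<T}) \<and>
        (v has_vector_derivative a t) (at t within {0..<T}) \<and>
        m *\<^sub>R a t = - (e * b (q t)) *\<^sub>R (J *v v t)"
    using traj unfolding magnetic_trajectory_def by blast
  have motion: "q t \<in> \<Omega>" "(q has_vector_derivative v t) (at t)" "(v has_vector_derivative a t) (at t)"
    "m *\<^sub>R a t = - (e * b (q t)) *\<^sub>R (J *v v t)" if "t0 < t" "t < T" for t
  proof -
    have t: "t \<in> {0..<T}" "t \<in> interior {0..<T}" using near[OF that] that by auto
    show "q t \<in> \<Omega>" "(q has_vector_derivative v t) (at t)" "(v has_vector_derivative a t) (at t)"
      "m *\<^sub>R a t = - (e * b (q t)) *\<^sub>R (J *v v t)"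
      using va[OF t(1)] at_within_interior[OF t(2)] by auto
  qed
  have diff: "(\<lambda>t. f (q t)) differentiable (at t)"
    if "t0 < t" "t < T" "\<And>y. y \<in> V \<Longrightarrow> f differentiable (at y)" for f :: "real^2 \<Rightarrow> real" and t
    using differentiable_chain_at[of q t f] motion(2)[OF that(1,2)] that(3) near[OF that(1,2)]
    by (auto simp: o_def intro: differentiableI_vector)
  show False
  proof (rule no_collision[OF collar assms(1,2) t0 motion(2,3,4) _ _ _ _ nq sq])
    fix t assume t: "t0 < t" "t < T"
    show "q t = X (n (q t)) (s (q t))" using X near[OF t] by simp
    then show "0 < n (q t)" using sides[of "n (q t)" "s (q t)"] near[OF t] motion(1)[OF t] by simp
    show "(\<lambda>t. n (q t)) differentiable (at t)" "(\<lambda>t. s (q t)) differentiable (at t)"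
      using diff[OF t] n s by auto
  qed (assumption | rule assms(12)[OF C])+
qed

end
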